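(* Let $c,\lambda,\kappa,\beta>0$. Consider the symmetric two-sided steady-state fluid benchmark with matching-cost function $f(x_1,x_2)=\kappa/(x_1x_2)^\beta$, mean arrival rate $\lambda/2$ for each of the two types, and equal waiting-cost rates $c_1=c_2=c$. For a common positive fluid queue level $\bar X>0$, the associated steady-state cost rate is $$\bar J(\bar X)=2c\bar X+\frac{\lambda}{2}\,\frac{\kappa}{\bar X^{2\beta}}.$$ Let $\bar X^*$ be the unique minimizer of $\bar J(\bar X)$ over $\bar X>0$. If $$W_{\mathrm{rate}}^*=2c\bar X^*,\qquad M_{\mathrm{rate}}^*=\frac{\lambda}{2}\,\frac{\kappa}{(\bar X^* )^{2\beta}}$$ denote the waiting-cost and matching-cost rates at this optimum, then $$\frac{W_{\mathrm{rate}}^*}{M_{\mathrm{rate}}^*}=2\beta.$$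
   Context: In the steady-state fluid benchmark, both queues are held at a common level $\bar X>0$, waiting cost accrues at rate $c_1\bar X+c_2\bar X=2c\bar X$, and matches occur at rate $\lambda/2$ (equal to the arrival rate of each type), each costing $f(\bar X,\bar X)=\kappa/\bar X^{2\beta}$. The function $\bar J$ is the sum of these two cost rates. *)

theory Defs
  imports "HOL-Analysis.Analysis"
begin

definition matching_cost :: "real \<Rightarrow> real \<Rightarrow> real \<Rightarrow> real \<Rightarrow> real" where
  "matching_cost \<kappa> \<beta> x1 x2 = \<kappa> / (x1 * x2) powr \<beta>"

text \<open>
  Cost rates of the steady-state fluid benchmark with both queues held at level \<open>X\<close>.
  In steady state the rate of matches equals the arrival rate \<open>a\<close> of each of the two types,
  and each match costs \<open>f X X\<close>.
\<close>

definition waiting_cost_rate :: "real \<Rightarrow> real \<Rightarrow> real \<Rightarrow> real" where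
  "waiting_cost_rate c1 c2 X = c1 * X + c2 * X"

definition matching_cost_rate :: "real \<Rightarrow> (real \<Rightarrow> real \<Rightarrow> real) \<Rightarrow> real \<Rightarrow> real" where
  "matching_cost_rate a f X = a * f X X"

definition fluid_cost_rate ::
  "real \<Rightarrow> real \<Rightarrow> real \<Rightarrow> (real \<Rightarrow> real \<Rightarrow> real) \<Rightarrow> real \<Rightarrow> real" where
  "fluid_cost_rate c1 c2 a f X = waiting_cost_rate c1 c2 X + matching_cost_rate a f X"

text \<open>
  The symmetric benchmark: \<open>c1 = c2 = c\<close>, and arrival rate \<open>\<Lambda> / 2\<close> per type.
\<close>

definition J_bar :: "real \<Rightarrow> real \<Rightarrow> real \<Rightarrow> real \<Rightarrow> real \<Rightarrow> real" where
  "J_bar c \<Lambda> \<kappa> \<beta> = fluid_cost_rate c c (\<Lambda> / 2) (matching_cost \<kappa> \<beta>)"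

end

theory Submission
  imports Defs
begin

text \<open>
  At a point \<open>x0\<close> where the linear term is \<open>p\<close> times the power term, every other point
  \<open>x = t x0\<close> has a strictly larger cost: after division by the power term at \<open>x0\<close> this says
  \<open>p t + t powr (-p) > p + 1\<close>, which follows from \<open>t powr (-p) \<ge> 1 - p ln t\<close> and
  \<open>ln t < t - 1\<close>. Such a balance point is therefore the unique minimizer, and the balance
  equation is the claimed ratio.
\<close>

lemma balance_point_exists:
  fixes a b p :: real
  assumes "a > 0" "b > 0" "p > 0"
  obtains x where "x > 0" "a * x = p * (b / x powr p)"
proof
  \<comment> \<open>Clearing the denominator turns the balance equation into
    \<open>x powr (p + 1) = p * b / a\<close>, whose positive root is this witness.\<close>
  let ?x = "(p * b / a) powr (1 / (p + 1))"
  show pos: "?x > 0" using assms by simp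
  have "?x * ?x powr p = ?x powr (p + 1)"
    using pos by (simp add: powr_add)
  also have "\<dots> = p * b / a"
    using assms by (simp add: powr_powr)
  finally have "a * (?x * ?x powr p) = p * b" using assms by simp
  moreover have "?x powr p > 0" using pos by simp
  ultimately show "a * ?x = p * (b / ?x powr p)"
    by (simp add: eq_divide_eq mult.assoc)
qed

lemma balance_point_strict_min:
  fixes a b p x x0 :: real
  assumes "b > 0" "p > 0" "x0 > 0" "x > 0" "x \<noteq> x0"
    and balance: "a * x0 = p * (b / x0 powr p)"
  shows "a * x0 + b / x0 powr p < a * x + b / x powr p"
proof -
  define t where "t = x / x0"
  define m where "m = b / x0 powr p"
  have t: "t > 0" "t \<noteq> 1" and x: "x = x0 * t" and m: "m > 0"
    using assms by (auto simp: t_def m_def)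
  \<comment> \<open>Strictness enters here, since equality forces \<open>t = 1\<close>; the
    exponential bound below is used only in its weak form.\<close>
  have "ln t < t - 1"
    using ln_le_minus_one[OF t(1)] ln_eq_minus_one[OF t(1)] t(2) by linarith
  then have "p * ln t < p * (t - 1)" using \<open>p > 0\<close> by simp
  moreover have "1 / t powr p = exp (- (p * ln t))"
    using t by (simp add: powr_def exp_minus inverse_eq_divide)
  moreover have "1 + - (p * ln t) \<le> exp (- (p * ln t))" by (rule exp_ge_add_one_self)
  ultimately have "p + 1 < p * t + 1 / t powr p" by (simp add: algebra_simps)
  \<comment> \<open>Scaling by \<open>m\<close> undoes the normalization: balance reads
    \<open>a * x0 = p * m\<close>, so both costs are \<open>m\<close> times the two sides.\<close>
  then have "m * (p + 1) < m * (p * t + 1 / t powr p)" using m by simp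
  moreover have "a * x0 + b / x0 powr p = m * (p + 1)"
    using balance by (simp add: m_def algebra_simps add_divide_distrib)
  moreover have "a * x = (p * m) * t"
    using balance by (simp add: x m_def mult.assoc [symmetric])
  moreover have "b / x powr p = m * (1 / t powr p)"
    using t \<open>x0 > 0\<close> by (simp add: x m_def powr_mult)
  ultimately show ?thesis by (simp add: algebra_simps)
qed

text \<open>A value strictly below all others cannot be undercut, and it undercuts every other
  candidate. As an equivalence, this yields existence and uniqueness together.\<close>

lemma is_arg_min_strict_iff:
  fixes f :: "'a \<Rightarrow> 'b :: order"
  assumes "P x0" "\<And>x. P x \<Longrightarrow> x \<noteq> x0 \<Longrightarrow> f x0 < f x"
  shows "is_arg_min f P x \<longleftrightarrow> x = x0"
  using assms unfolding is_arg_min_def by (metis less_asym less_irrefl)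

lemma matching_cost_diag:
  assumes "X > 0"
  shows "matching_cost \<kappa> \<beta> X X = \<kappa> / X powr (2 * \<beta>)"
  using assms by (simp add: matching_cost_def powr_mult flip: powr_add)

lemma J_bar_eq:
  assumes "X > 0"
  shows "J_bar c \<Lambda> \<kappa> \<beta> X = 2 * c * X + \<Lambda> / 2 * (\<kappa> / X powr (2 * \<beta>))"
  using assms by (simp add: J_bar_def fluid_cost_rate_def waiting_cost_rate_def
      matching_cost_rate_def matching_cost_diag)

theorem proposition2:
  fixes c \<Lambda> \<kappa> \<beta> :: real
  assumes "c > 0" and "\<Lambda> > 0" and "\<kappa> > 0" and "\<beta> > 0"
  shows "(\<forall>X>0. waiting_cost_rate c c X = 2 * c * X
            \<and> matching_cost_rate (\<Lambda> / 2) (matching_cost \<kappa> \<beta>) X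
                = \<Lambda> / 2 * (\<kappa> / X powr (2 * \<beta>))
            \<and> J_bar c \<Lambda> \<kappa> \<beta> X = 2 * c * X + \<Lambda> / 2 * (\<kappa> / X powr (2 * \<beta>)))
    \<and> (\<exists>!X. is_arg_min (J_bar c \<Lambda> \<kappa> \<beta>) (\<lambda>X. X > 0) X)
    \<and> (\<forall>X_star. is_arg_min (J_bar c \<Lambda> \<kappa> \<beta>) (\<lambda>X. X > 0) X_star \<longrightarrow>
         (let W_rate = 2 * c * X_star;
              M_rate = \<Lambda> / 2 * (\<kappa> / X_star powr (2 * \<beta>))
          in W_rate / M_rate = 2 * \<beta>))"
proof -
  \<comment> \<open>The exponent \<open>2 * \<beta>\<close> of the power term serves as
    \<open>p\<close>, and this is where the claimed ratio comes from.\<close>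
  obtain x0 where x0: "x0 > 0"
    and balance: "2 * c * x0 = 2 * \<beta> * (\<Lambda> / 2 * \<kappa> / x0 powr (2 * \<beta>))"
    using balance_point_exists[of "2 * c" "\<Lambda> / 2 * \<kappa>" "2 * \<beta>"] assms by auto
  have "J_bar c \<Lambda> \<kappa> \<beta> x0 < J_bar c \<Lambda> \<kappa> \<beta> X" if "X > 0" "X \<noteq> x0" for X
    using balance_point_strict_min[OF _ _ x0 that balance] assms that x0
    by (simp add: J_bar_eq)
  then have arg_min: "is_arg_min (J_bar c \<Lambda> \<kappa> \<beta>) (\<lambda>X. X > 0) X \<longleftrightarrow> X = x0" for X
    using x0 by (intro is_arg_min_strict_iff)
  \<comment> \<open>Balance makes the numerator \<open>2 * \<beta>\<close> times the denominator,
    which is positive and cancels.\<close>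
  have "2 * c * x0 / (\<Lambda> / 2 * (\<kappa> / x0 powr (2 * \<beta>))) = 2 * \<beta>"
    unfolding balance using assms x0 by simp
  then show ?thesis
    by (simp add: arg_min J_bar_eq waiting_cost_rate_def matching_cost_rate_def
        matching_cost_diag)
qed

end
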